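(* Let $m>1$. There is a constant $C>0$ such that the following holds. Let $f(t,x)$ be radial in $x\in\mathbb{R}^3$ and assume $$\|f\|_{L^1_tL^m_x(r^mdr)}:=\int_{-\infty}^{+\infty}\Big(\int_0^{+\infty}|f(t,r)|^m\,r^m\,dr\Big)^{1/m}dt<\infty.$$ Let $u(t,r)$ be the solution of $(\partial_t^2-\Delta)u=f$ on $\mathbb{R}\times\mathbb{R}^3$ with $(u,\partial_tu)|_{t=0}=(0,0)$. Then $$\|u\|_{S(\mathbb{R})}\leq C\,\|f\|_{L^1_tL^m_x(r^mdr)}.$$
   Context: Here $r=|x|$ and $$\|u\|_{S(\mathbb{R})}=\Big(\int_{\mathbb{R}}\Big(\int_0^{+\infty}|u(t,r)|^{(2m+1)m}\,r^m\,dr\Big)^{1/m}dt\Big)^{\frac{1}{2m+1}}.$$ The solution $u$ is given by Duhamel's formula $u(t)=\int_0^t\frac{\sin((t-s)\sqrt{-\Delta})}{\sqrt{-\Delta}}f(s)\,ds$, i.e. $u(t,r)=\frac1{2r}\int_0^t\int_{\tau-r}^{\tau+r}g(t-\tau,\sigma)\,d\sigma\,d\tau$ with $g(t,\rho)=\rho f(t,|\rho|)$. *)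

theory Defs
  imports "HOL-Analysis.Analysis"
begin

definition radial :: "(real^3 \<Rightarrow> real) \<Rightarrow> bool" where
  "radial h \<longleftrightarrow> (\<forall>x y. norm x = norm y \<longrightarrow> h x = h y)"

text \<open>The function \<open>r \<mapsto> h(r)\<close> of the radius attached to a radial \<open>h\<close>, read off along the first
  coordinate axis; for radial \<open>h\<close> the choice of the axis is immaterial.\<close>

definition profile :: "(real^3 \<Rightarrow> real) \<Rightarrow> real \<Rightarrow> real" where
  "profile h r = h (r *\<^sub>R axis 1 1)"

text \<open>Real powers of extended nonnegative numbers, used for exponents \<open>p > 0\<close> only.\<close>

definition ennpowr :: "ennreal \<Rightarrow> real \<Rightarrow> ennreal" where
  "ennpowr a p = (if a = \<infinity> then \<infinity> else ennreal (enn2real a powr p))"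

text \<open>The norm of \<open>L\<^sup>1\<^sub>t L\<^sup>m\<^sub>x(r\<^sup>m dr)\<close> and the norm of \<open>S(\<real>)\<close>, with values in \<open>[0, \<infinity>]\<close>.\<close>

definition norm_L1Lm :: "real \<Rightarrow> (real \<Rightarrow> real^3 \<Rightarrow> real) \<Rightarrow> ennreal" where
  "norm_L1Lm m f =
     (\<integral>\<^sup>+t. ennpowr
        (\<integral>\<^sup>+r\<in>{0<..}. ennreal (\<bar>profile (f t) r\<bar> powr m * r powr m) \<partial>lebesgue)
        (1 / m) \<partial>lebesgue)"

definition norm_S :: "real \<Rightarrow> (real \<Rightarrow> real^3 \<Rightarrow> real) \<Rightarrow> ennreal" where
  "norm_S m u =
     ennpowr
       (\<integral>\<^sup>+t. ennpowr
          (\<integral>\<^sup>+r\<in>{0<..}. ennreal (\<bar>profile (u t) r\<bar> powr ((2*m + 1) * m) * r powr m) \<partial>lebesgue)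
          (1 / m) \<partial>lebesgue)
       (1 / (2*m + 1))"

text \<open>The solution of \<open>(\<partial>\<^sub>t\<^sup>2 - \<Delta>)u = f\<close> with zero data at \<open>t = 0\<close>, for \<open>f\<close> radial in \<open>x\<close>, given by
  Duhamel's formula: the odd extension \<open>g(t, \<rho>) = \<rho> f(t, \<bar>\<rho>\<bar>)\<close> is the source of the
  one-dimensional wave equation satisfied by \<open>r u\<close>. The integral over \<open>\<tau>\<close> is oriented, so
  that negative times are covered as well. At \<open>x = 0\<close>, a null set, the value is \<open>0\<close>.\<close>

definition odd_source :: "(real \<Rightarrow> real^3 \<Rightarrow> real) \<Rightarrow> real \<Rightarrow> real \<Rightarrow> real" where
  "odd_source f t \<rho> = \<rho> * profile (f t) \<bar>\<rho>\<bar>"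

definition wave_duhamel :: "(real \<Rightarrow> real^3 \<Rightarrow> real) \<Rightarrow> real \<Rightarrow> real^3 \<Rightarrow> real" where
  "wave_duhamel f t x =
     1 / (2 * norm x) *
     (LINT \<tau>=0..ereal t|lebesgue.
        (LINT \<sigma>=ereal (\<tau> - norm x)..ereal (\<tau> + norm x)|lebesgue. odd_source f (t - \<tau>) \<sigma>))"

end

theory Submission
  imports Defs
begin

text \<open>
  Write \<open>q = 2m + 1\<close>. Let \<open>G (s, \<sigma>)\<close> be the absolute value of the odd source at time \<open>s\<close>, let \<open>a s\<close> be its
  \<open>L\<^sup>m\<close> norm in \<open>\<sigma>\<close>, and let \<open>S\<close> be the integral of \<open>a\<close>. Taking absolute values in Duhamel's formula bounds
  \<open>\<bar>u (t, r)\<bar>\<close> by the majorant \<open>U (t, r)\<close>, the integral over \<open>s\<close> of the averages of \<open>G (s, _)\<close> over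
  \<open>{t - s - r<..<t - s + r}\<close>. The estimate then follows from three observations about \<open>U\<close>.

  First, \<open>r * U (t, r)\<close> increases with \<open>r\<close>. Hence \<open>U\<close> has a doubling property that controls the inner
  integral in the norm of \<open>u\<close>, raised to the power \<open>1/m\<close>, by the integral of
  \<open>U powr q * r powr (1/m)\<close> over \<open>r\<close> (\<open>mixed_norm_le_of_doubling\<close>). It remains to bound a plain spacetime
  integral by a multiple of \<open>S powr q\<close>.

  Second, \<open>U \<le> 2 S r powr (-1/m)\<close> by Hoelder's inequality on intervals (\<open>majorant_decay\<close>). So only
  values of \<open>G\<close> up to the level \<open>a s * r powr (-1/m)\<close> deserve the full power \<open>q\<close>: for
  \<open>0 < c \<le> r powr (-1/m)\<close> one has \<open>G \<le> c a + c powr (-2m) * T\<close>, where \<open>T\<close> is the minimum of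
  \<open>G * (G / a) powr (2m)\<close> and \<open>G / r\<^sup>2\<close> (\<open>le_level_plus_trunc_power\<close>). Averaging this and choosing
  \<open>c = U / (2 S)\<close>, which the decay of \<open>U\<close> permits, gives \<open>U powr q \<le> 2 powr q * S powr (2m)\<close> times the mean
  of \<open>T\<close> (\<open>majorant_power_le_trunc_mean\<close>). This one step does the summation over \<open>s\<close> and the real
  interpolation in the size of \<open>G\<close> together.

  Third, integration in \<open>t\<close> removes the averages, and integrating \<open>r powr (1/m) * T\<close> over \<open>r\<close> gives a
  multiple of \<open>a powr (1 - m) * G powr m\<close> (\<open>nn_integral_trunc_power_le\<close>); here \<open>m > 1\<close> makes the tail
  converge. Integrating over \<open>\<sigma>\<close> and then over \<open>s\<close> leaves \<open>S\<close>, which completes the bound by \<open>S powr q\<close>.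

  Since the source is only Lebesgue measurable on spacetime, \<open>G\<close> is built from a Borel representative,
  which agrees with the source on almost every slice (\<open>wave_source_of_finite_norm\<close>).
\<close>

section \<open>Truncated powers\<close>

text \<open>For \<open>a\<close> the norm of a slice and \<open>\<lambda> = a r powr (-1/m)\<close> the level of the radius \<open>r\<close>, this is
  \<open>a powr (-2m)\<close> times \<open>min (y powr (2m+1)) (\<lambda> powr (2m) * y)\<close>: the power \<open>2m+1\<close> below the level, continued
  linearly above it.\<close>

definition trunc_power :: "real \<Rightarrow> real \<Rightarrow> real \<Rightarrow> real \<Rightarrow> real" where
  "trunc_power m a r y = min (y * (y / a) powr (2*m)) (y / r\<^sup>2)"

lemma trunc_power_nonneg: "0 \<le> y \<Longrightarrow> 0 \<le> trunc_power m a r y"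
  by (simp add: trunc_power_def)

lemma trunc_power_measurable [measurable (raw)]:
  assumes [measurable]: "a \<in> borel_measurable M" "r \<in> borel_measurable M" "y \<in> borel_measurable M"
  shows "(\<lambda>x. trunc_power m (a x) (r x) (y x)) \<in> borel_measurable M"
  unfolding trunc_power_def by measurable

text \<open>Either \<open>y\<close> is below the level \<open>c a\<close>, or the quotient of \<open>y\<close> by the level is at least \<open>1\<close> and
  only increases when raised to the power \<open>m\<close>. Integrated over an interval, such a bound does the
  work of Hoelder's inequality up to a factor.\<close>

lemma le_level_plus_power:
  fixes m a c y :: real
  assumes "m > 1" "a > 0" "c > 0" "y \<ge> 0"
  shows "y \<le> c * a + (c * a) powr (1 - m) * y powr m"
proof (cases "y \<le> c * a")
  case True
  then show ?thesis by (simp add: add_increasing2)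
next
  case False
  have ca: "c * a > 0" using assms by simp
  have "y = y powr (1 - m) * y powr m"
    using False ca by (simp flip: powr_add)
  also have "\<dots> \<le> (c * a) powr (1 - m) * y powr m"
    using False ca assms by (intro mult_right_mono powr_mono2') auto
  finally show ?thesis using ca by linarith
qed

text \<open>The same dichotomy for the truncated power. Linear continuation above the level \<open>a r powr (-1/m)\<close>
  is harmless as long as the level \<open>c a\<close> does not exceed it, which is the upper bound on \<open>c\<close>.\<close>

lemma le_level_plus_trunc_power:
  fixes m a c r y :: real
  assumes "m > 1" "a > 0" "c > 0" "r > 0" "c \<le> r powr (-1/m)" "y \<ge> 0"
  shows "y \<le> c * a + c powr (-(2*m)) * trunc_power m a r y"
proof (cases "y \<le> c * a")
  case True
  then show ?thesis using assms by (simp add: add_increasing2 trunc_power_nonneg)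
next
  case False
  have ca: "c * a > 0" using assms by simp
  have "1 \<le> (y / a) / c" using False assms by (simp add: field_simps)
  then have "1 \<le> ((y / a) / c) powr (2*m)"
    using assms by (intro ge_one_powr_ge_zero) auto
  also have "((y / a) / c) powr (2*m) = (y / a) powr (2*m) / c powr (2*m)"
    by (rule powr_divide)
  also have "\<dots> = c powr (-(2*m)) * (y / a) powr (2*m)"
    by (simp only: powr_minus divide_inverse mult.commute)
  finally have "y * 1 \<le> y * (c powr (-(2*m)) * (y / a) powr (2*m))"
    using assms by (intro mult_left_mono)
  then have 1: "y \<le> c powr (-(2*m)) * (y * (y / a) powr (2*m))"
    by (simp add: mult.left_commute)
  have "r\<^sup>2 = (r powr (-1/m)) powr (-(2*m))"
    using assms by (simp add: powr_powr flip: powr_numeral)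
  also have "\<dots> \<le> c powr (-(2*m))"
    using assms by (intro powr_mono2') auto
  finally have "y * 1 \<le> y * (c powr (-(2*m)) / r\<^sup>2)"
    using assms by (intro mult_left_mono) (auto simp: field_simps)
  then have 2: "y \<le> c powr (-(2*m)) * (y / r\<^sup>2)"
    by (simp add: mult.commute)
  have "y \<le> c powr (-(2*m)) * trunc_power m a r y"
    using 1 2 by (auto simp: trunc_power_def min_def)
  then show ?thesis using ca by linarith
qed

text \<open>The two branches meet at \<open>r = (a / y) powr m\<close>. Below that radius the exponent \<open>1/m\<close> is integrable
  at \<open>0\<close>; beyond it the exponent \<open>1/m - 2\<close> is integrable at infinity because \<open>m > 1\<close>. Both pieces are
  multiples of \<open>a powr (1 - m) * y powr m\<close>.\<close>

lemma nn_integral_trunc_power_le: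
  fixes m a y :: real
  assumes "m > 1" "a \<ge> 0" "y \<ge> 0"
  shows "(\<integral>\<^sup>+r\<in>{0<..}. ennreal (r powr (1/m) * trunc_power m a r y) \<partial>lborel)
           \<le> ennreal (2 * m / (m - 1) * (a powr (1 - m) * y powr m))"
proof (cases "a = 0 \<or> y = 0")
  case True
  then have "trunc_power m a r y = 0" for r
    using assms by (auto simp: trunc_power_def min_def)
  then show ?thesis by simp
next
  case False
  with assms have ay: "a > 0" "y > 0" by auto
  define R where "R = (a / y) powr m"
  have R: "R > 0" using ay by (simp add: R_def)
  have yR: "R powr (1/m - 1) = (a/y) powr (1 - m)"
    using assms by (simp add: R_def powr_powr algebra_simps)
  define A where "A = y * (y / a) powr (2*m)"
  have A: "A \<ge> 0" using ay by (simp add: A_def)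
  have low: "(\<integral>\<^sup>+r. ennreal (r powr (1/m)) * indicator {0..R} r \<partial>lborel)
      = ennreal (R powr (1/m+1) / (1/m+1))"
    using assms R by (intro nn_integral_has_integral_lebesgue' has_integral_powr_from_0)
      (auto intro: order_less_le_trans[of "-1" 0])
  have e: "1/m - 2 < -1" using assms by simp
  have high: "(\<integral>\<^sup>+r. ennreal (r powr (1/m - 2)) * indicator {R..} r \<partial>lborel)
      = ennreal (-(R powr (1/m - 2 + 1)) / (1/m - 2 + 1))"
    by (intro nn_integral_has_integral_lebesgue' has_integral_powr_to_inf e R) auto
  have "(\<integral>\<^sup>+r\<in>{0<..}. ennreal (r powr (1/m) * trunc_power m a r y) \<partial>lborel)
     \<le> (\<integral>\<^sup>+r. ennreal A * (ennreal (r powr (1/m)) * indicator {0..R} r)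
            + ennreal y * (ennreal (r powr (1/m - 2)) * indicator {R..} r) \<partial>lborel)"
  proof (intro nn_integral_mono)
    fix r :: real
    have *: "r powr (1/m) * trunc_power m a r y \<le> A * r powr (1/m)"
      unfolding trunc_power_def A_def by (subst mult.commute) (intro mult_right_mono, auto)
    have **: "r powr (1/m) * trunc_power m a r y \<le> y * r powr (1/m - 2)" if "r > 0"
    proof -
      have "r powr (1/m) * trunc_power m a r y \<le> r powr (1/m) * (y / r\<^sup>2)"
        unfolding trunc_power_def by (intro mult_left_mono) auto
      also have "\<dots> = y * r powr (1/m - 2)"
        using that by (simp add: powr_diff powr_numeral)
      finally show ?thesis .
    qed
    show "ennreal (r powr (1/m) * trunc_power m a r y) * indicator {0<..} r
       \<le> ennreal A * (ennreal (r powr (1/m)) * indicator {0..R} r)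
            + ennreal y * (ennreal (r powr (1/m - 2)) * indicator {R..} r)"
    proof (cases "r \<le> R")
      case True
      then show ?thesis using * A
        by (auto simp: indicator_def simp flip: ennreal_mult' intro!: add_increasing2 ennreal_leI)
    next
      case False
      then show ?thesis using ** ay R
        by (auto simp: indicator_def simp flip: ennreal_mult' intro!: add_increasing ennreal_leI)
    qed
  qed
  also have "\<dots> = ennreal A * ennreal (R powr (1/m+1) / (1/m+1))
      + ennreal y * ennreal (-(R powr (1/m - 2 + 1)) / (1/m - 2 + 1))"
    by (subst nn_integral_add) (auto simp: nn_integral_cmult low high)
  also have "\<dots> = ennreal (A * R powr (1/m+1) / (1/m+1) + y * R powr (1/m - 1) / (1 - 1/m))"
  proof -
    have e1: "-(R powr (1/m - 2 + 1)) / (1/m - 2 + 1) = R powr (1/m - 1) / (1 - 1/m)"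
      by (simp add: minus_divide_left[symmetric] divide_minus_right[symmetric] del: divide_minus_right)
    have "1 - 1/m > 0" "1/m + 1 > 0" using assms by (auto intro: add_pos_pos)
    then show ?thesis
      unfolding e1 using A ay by (simp add: ennreal_plus flip: ennreal_mult')
  qed
  also have "y * R powr (1/m - 1) = a powr (1 - m) * y powr m"
    unfolding yR using ay by (simp add: powr_divide powr_diff field_simps)
  also have "A * R powr (1/m+1) = a powr (1 - m) * y powr m"
  proof -
    have "(y / a) powr (2*m) = (a / y) powr (-(2*m))"
      using ay by (simp add: powr_divide powr_minus field_simps)
    moreover have "R powr (1/m+1) = (a/y) powr (1 + m)"
      using assms by (simp add: R_def powr_powr algebra_simps)
    ultimately have "A * R powr (1/m+1) = y * (a/y) powr (1 - m)"
      by (simp add: A_def flip: powr_add)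
    then show ?thesis
      using ay by (simp add: powr_divide powr_diff field_simps)
  qed
  also have "a powr (1 - m) * y powr m / (1/m + 1) + a powr (1 - m) * y powr m / (1 - 1/m)
     \<le> 2 * m / (m - 1) * (a powr (1 - m) * y powr m)"
  proof -
    let ?w = "a powr (1 - m) * y powr m"
    have "?w / (1/m + 1) \<le> ?w / (1 - 1/m)"
      using assms by (intro divide_left_mono mult_pos_pos) (auto intro: add_pos_pos simp: field_simps)
    moreover have "?w / (1 - 1/m) = m / (m - 1) * ?w"
      using assms by (simp add: field_simps)
    ultimately have "?w / (1/m + 1) + ?w / (1 - 1/m) \<le> 2 * (m / (m - 1) * ?w)"
      by linarith
    then show ?thesis by (simp add: mult.assoc)
  qed
  finally show ?thesis by (simp add: ennreal_leI)
qed

section \<open>Averages over characteristic strips\<close>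

text \<open>For a source \<open>K\<close> of the half-line wave equation, extended to the line, this is the Duhamel integral
  over all source times \<open>s\<close>: the average of \<open>K (s, _)\<close> over the interval of radius \<open>r\<close> about \<open>t - s\<close>,
  integrated in \<open>s\<close>. The condition on \<open>(s, \<sigma>)\<close> describes a strip along a characteristic.\<close>

definition strip_mean :: "(real \<times> real \<Rightarrow> ennreal) \<Rightarrow> real \<Rightarrow> real \<Rightarrow> ennreal" where
  "strip_mean K t r = ennreal (1 / (2*r)) *
     (\<integral>\<^sup>+s. \<integral>\<^sup>+\<sigma>. K (s, \<sigma>) * indicator {-r<..<r} (\<sigma> + s - t) \<partial>lborel \<partial>lborel)"

lemma strip_mean_mono_AE:
  assumes "AE s in lborel. AE \<sigma> in lborel. K (s, \<sigma>) \<le> L (s, \<sigma>)"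
  shows "strip_mean K t r \<le> strip_mean L t r"
  unfolding strip_mean_def
proof (intro mult_left_mono nn_integral_mono_AE)
  show "AE s in lborel. (\<integral>\<^sup>+\<sigma>. K (s, \<sigma>) * indicator {-r<..<r} (\<sigma> + s - t) \<partial>lborel)
      \<le> (\<integral>\<^sup>+\<sigma>. L (s, \<sigma>) * indicator {-r<..<r} (\<sigma> + s - t) \<partial>lborel)"
    using assms
  proof eventually_elim
    case (elim s)
    show ?case
      by (intro nn_integral_mono_AE) (use elim in eventually_elim, auto intro: mult_right_mono)
  qed
qed simp

lemma strip_indicator_measurable [measurable]:
  fixes r :: "_ \<Rightarrow> real"
  assumes [measurable]: "g \<in> borel_measurable M" "r \<in> borel_measurable M"
  shows "(\<lambda>x. indicator {-r x<..<r x} (g x :: real) :: ennreal) \<in> borel_measurable M"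
proof -
  have "(\<lambda>x. indicator {-r x<..<r x} (g x) :: ennreal) = (\<lambda>x. if -r x < g x \<and> g x < r x then 1 else 0)"
    by (auto simp: indicator_def)
  then show ?thesis by simp
qed

lemma strip_mean_measurable:
  assumes [measurable]: "K \<in> borel_measurable (borel \<Otimes>\<^sub>M borel)"
  shows "(\<lambda>p. strip_mean K (fst p) (snd p)) \<in> borel_measurable (borel \<Otimes>\<^sub>M borel)"
  unfolding strip_mean_def by measurable

lemma strip_mean_add:
  assumes [measurable]: "K \<in> borel_measurable (borel \<Otimes>\<^sub>M borel)" "L \<in> borel_measurable (borel \<Otimes>\<^sub>M borel)"
  shows "strip_mean (\<lambda>p. K p + L p) t r = strip_mean K t r + strip_mean L t r"
  unfolding strip_mean_def
  by (simp add: nn_integral_add distrib_left distrib_right)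

lemma strip_mean_cmult:
  assumes [measurable]: "K \<in> borel_measurable (borel \<Otimes>\<^sub>M borel)"
  shows "strip_mean (\<lambda>p. c * K p) t r = c * strip_mean K t r"
  unfolding strip_mean_def by (simp add: nn_integral_cmult mult.assoc mult.left_commute)

lemma nn_integral_window:
  assumes "r > 0"
  shows "(\<integral>\<^sup>+\<sigma>. indicator {-r<..<r} (\<sigma> + x) \<partial>lborel) = ennreal (2 * r)"
proof -
  have "(\<integral>\<^sup>+\<sigma>. indicator {-r<..<r} (\<sigma> + x) \<partial>lborel) = (\<integral>\<^sup>+\<sigma>. indicator {-r-x<..<r-x} \<sigma> \<partial>lborel)"
    by (intro nn_integral_cong) (auto simp: indicator_def)
  then show ?thesis using assms by simp
qed

lemma strip_mean_of_time_function:
  assumes [measurable]: "w \<in> borel_measurable borel" and r: "r > 0"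
  shows "strip_mean (\<lambda>p. w (fst p)) t r = (\<integral>\<^sup>+s. w s \<partial>lborel)"
proof -
  have "(\<integral>\<^sup>+s. \<integral>\<^sup>+\<sigma>. w s * indicator {-r<..<r} (\<sigma> + s - t) \<partial>lborel \<partial>lborel)
      = (\<integral>\<^sup>+s. ennreal (2 * r) * w s \<partial>lborel)"
    using nn_integral_window[OF r, of "s - t" for s]
    by (intro nn_integral_cong) (simp add: nn_integral_cmult add_diff_eq mult.commute)
  then show ?thesis
    using r by (simp add: strip_mean_def nn_integral_cmult mult.assoc[symmetric] ennreal_mult'[symmetric])
qed

text \<open>Averaging over windows of a fixed width preserves the integral over the line, by Tonelli: each
  \<open>(s, \<sigma>)\<close> is seen by a set of times \<open>t\<close> of measure \<open>2 r\<close>.\<close>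

lemma nn_integral_strip_mean:
  assumes [measurable]: "K \<in> borel_measurable (borel \<Otimes>\<^sub>M borel)" and r: "r > 0"
  shows "(\<integral>\<^sup>+t. strip_mean K t r \<partial>lborel) = (\<integral>\<^sup>+s. \<integral>\<^sup>+\<sigma>. K (s, \<sigma>) \<partial>lborel \<partial>lborel)"
proof -
  have window: "(\<integral>\<^sup>+t. indicator {-r<..<r} (x - t) \<partial>lborel) = ennreal (2 * r)" for x :: real
  proof -
    have "(\<integral>\<^sup>+t. indicator {-r<..<r} (x - t) \<partial>lborel) = (\<integral>\<^sup>+t. indicator {x-r<..<x+r} t \<partial>lborel)"
      by (intro nn_integral_cong) (auto simp: indicator_def)
    then show ?thesis using r by simp
  qed
  have "(\<integral>\<^sup>+t. \<integral>\<^sup>+s. \<integral>\<^sup>+\<sigma>. K (s, \<sigma>) * indicator {-r<..<r} (\<sigma> + s - t) \<partial>lborel \<partial>lborel \<partial>lborel)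
      = (\<integral>\<^sup>+s. \<integral>\<^sup>+t. \<integral>\<^sup>+\<sigma>. K (s, \<sigma>) * indicator {-r<..<r} (\<sigma> + s - t) \<partial>lborel \<partial>lborel \<partial>lborel)"
    by (intro lborel_pair.Fubini') measurable
  also have "\<dots> = (\<integral>\<^sup>+s. \<integral>\<^sup>+\<sigma>. \<integral>\<^sup>+t. K (s, \<sigma>) * indicator {-r<..<r} (\<sigma> + s - t) \<partial>lborel \<partial>lborel \<partial>lborel)"
    by (intro nn_integral_cong lborel_pair.Fubini') measurable
  also have "\<dots> = ennreal (2 * r) * (\<integral>\<^sup>+s. \<integral>\<^sup>+\<sigma>. K (s, \<sigma>) \<partial>lborel \<partial>lborel)"
    by (simp add: nn_integral_cmult window mult.commute[of _ "ennreal (2*r)"])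
  finally show ?thesis
    using r by (simp add: strip_mean_def nn_integral_cmult mult.assoc[symmetric] ennreal_mult'[symmetric])
qed

text \<open>The strips grow with their width, so only the normalisation \<open>1 / (2 r)\<close> can lose a factor.\<close>

lemma strip_mean_overlap:
  assumes "0 < r" "r \<le> \<rho>" "\<rho> \<le> 2 * r"
  shows "strip_mean K t r \<le> 2 * strip_mean K t \<rho>"
proof -
  let ?I = "\<lambda>r. \<integral>\<^sup>+s. \<integral>\<^sup>+\<sigma>. K (s, \<sigma>) * indicator {-r<..<r} (\<sigma> + s - t) \<partial>lborel \<partial>lborel"
  have I: "?I r \<le> ?I \<rho>"
    using assms by (intro nn_integral_mono mult_left_mono) (auto simp: indicator_def)
  have "strip_mean K t r \<le> (2 * ennreal (1 / (2 * \<rho>))) * ?I \<rho>"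
    unfolding strip_mean_def
  proof (intro mult_mono I)
    have "1 / (2 * r) \<le> 2 * (1 / (2 * \<rho>))"
      using assms by (simp add: field_simps)
    then show "ennreal (1 / (2 * r)) \<le> 2 * ennreal (1 / (2 * \<rho>))"
      by (metis ennreal_leI ennreal_mult' ennreal_numeral zero_le_numeral)
  qed auto
  then show ?thesis by (simp add: strip_mean_def mult.assoc)
qed

section \<open>Extended powers and mixed norms in the radius\<close>

lemma ennpowr_ennreal: "0 \<le> x \<Longrightarrow> ennpowr (ennreal x) p = ennreal (x powr p)"
  by (simp add: ennpowr_def)

lemma ennpowr_mono:
  assumes "a \<le> b" "0 \<le> p"
  shows "ennpowr a p \<le> ennpowr b p"
proof (cases b)
  case (real y)
  with assms obtain x where "a = ennreal x" "0 \<le> x" "x \<le> y"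
    by (cases a) (auto simp: top_unique)
  then show ?thesis using real assms by (simp add: ennpowr_ennreal ennreal_leI powr_mono2)
qed (simp add: ennpowr_def)

lemma ennpowr_cmult:
  assumes "0 < c"
  shows "ennpowr (ennreal c * a) p = ennreal (c powr p) * ennpowr a p"
proof (cases a)
  case (real x)
  then show ?thesis using assms
    by (simp add: ennpowr_ennreal powr_mult flip: ennreal_mult')
next
  case top
  then show ?thesis using assms by (simp add: ennpowr_def ennreal_mult_top)
qed

lemma ennpowr_measurable [measurable (raw)]:
  assumes [measurable]: "f \<in> borel_measurable M"
  shows "(\<lambda>x. ennpowr (f x) p) \<in> borel_measurable M"
  unfolding ennpowr_def by measurable

text \<open>The doubling hypothesis turns an integral bound into a pointwise one: writing \<open>B\<close> for
  the integral on the right, the part over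
  \<open>{r..2 r}\<close> already shows \<open>\<phi> r powr (2m+1) * r powr (1/m + 1) \<le> 2 powr (2m+1) * B\<close> pointwise, and
  \<open>m - 1\<close> factors of this kind turn the integrand on the left into the one on the right.\<close>

lemma mixed_norm_le_of_doubling:
  fixes m :: real and \<phi> :: "real \<Rightarrow> real"
  assumes m: "m > 1" and [measurable]: "\<phi> \<in> borel_measurable borel" and nonneg: "\<And>r. 0 \<le> \<phi> r"
    and doubling: "\<And>r \<rho>. 0 < r \<Longrightarrow> r \<le> \<rho> \<Longrightarrow> \<rho> \<le> 2 * r \<Longrightarrow> \<phi> r \<le> 2 * \<phi> \<rho>"
  shows "ennpowr (\<integral>\<^sup>+r\<in>{0<..}. ennreal (\<phi> r powr ((2*m + 1) * m) * r powr m) \<partial>lborel) (1 / m)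
     \<le> ennreal (2 powr (2*m + 1)) *
        (\<integral>\<^sup>+r\<in>{0<..}. ennreal (\<phi> r powr (2*m + 1) * r powr (1/m)) \<partial>lborel)"
    (is "ennpowr ?N _ \<le> _ * ?B")
proof (cases ?B)
  case top
  then show ?thesis by (simp add: ennreal_mult_top)
next
  case (real b)
  define D where "D = 2 powr (2*m + 1) * b"
  have bD: "b \<le> D" "0 \<le> D" using real m by (auto simp: D_def mult_le_cancel_right1 ge_one_powr_ge_zero)
  have point: "\<phi> r powr (2*m + 1) * r powr (1/m + 1) \<le> D" if r: "r > 0" for r
  proof -
    let ?v = "(\<phi> r / 2) powr (2*m + 1) * r powr (1/m)"
    \<comment> \<open>the constant ?v is a lower bound for the integrand on an interval of length r\<close>
    have "ennreal (?v * r) = (\<integral>\<^sup>+\<rho>. ennreal ?v * indicator {r..2*r} \<rho> \<partial>lborel)"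
      using r by (simp add: nn_integral_cmult_indicator ennreal_mult')
    also have "\<dots> \<le> ?B"
    proof (intro nn_integral_mono)
      fix \<rho> :: real
      show "ennreal ?v * indicator {r..2*r} \<rho>
          \<le> ennreal (\<phi> \<rho> powr (2*m + 1) * \<rho> powr (1/m)) * indicator {0<..} \<rho>"
      proof (cases "\<rho> \<in> {r..2*r}")
        case True
        then have "\<phi> r / 2 \<le> \<phi> \<rho>" using doubling[of r \<rho>] r by auto
        then have "?v \<le> \<phi> \<rho> powr (2*m + 1) * \<rho> powr (1/m)"
          using True r m nonneg by (intro mult_mono powr_mono2) auto
        then show ?thesis using True r by (auto simp: ennreal_leI)
      qed auto
    qed
    finally have "?v * r \<le> b" using real by simp
    moreover have "?v * r = \<phi> r powr (2*m + 1) * r powr (1/m + 1) / 2 powr (2*m + 1)"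
      using r by (simp add: powr_divide powr_add[of r])
    ultimately have "\<phi> r powr (2*m + 1) * r powr (1/m + 1) / 2 powr (2*m + 1) \<le> b" by simp
    then show ?thesis by (subst (asm) pos_divide_le_eq) (auto simp: D_def mult.commute)
  qed
  have "?N \<le> (\<integral>\<^sup>+r. ennreal (D powr (m - 1)) *
      (ennreal (\<phi> r powr (2*m + 1) * r powr (1/m)) * indicator {0<..} r) \<partial>lborel)"
  proof (intro nn_integral_mono)
    fix r :: real
    have "\<phi> r powr ((2*m + 1) * m) * r powr m
        \<le> D powr (m - 1) * (\<phi> r powr (2*m + 1) * r powr (1/m))" if r: "r > 0"
    proof -
      let ?w = "\<phi> r powr (2*m + 1)"
      have pw: "x powr (\<alpha> * \<beta> + \<gamma>) = (x powr \<alpha>) powr \<beta> * x powr \<gamma>" for x \<alpha> \<beta> \<gamma> :: real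
        by (simp only: powr_add powr_powr)
      have e: "(2*m + 1) * (m - 1) + (2*m + 1) = (2*m + 1) * m"
        "(1/m + 1) * (m - 1) + 1/m = m"
        using m by (simp_all add: field_simps)
      have "(?w * r powr (1/m + 1)) powr (m - 1) * (?w * r powr (1/m))
          = \<phi> r powr ((2*m + 1) * (m - 1) + (2*m + 1)) * r powr ((1/m + 1) * (m - 1) + 1/m)"
        by (simp only: pw[of _ "2*m + 1" "m - 1" "2*m + 1"] pw[of _ "1/m + 1" "m - 1" "1/m"]
            powr_mult) (simp only: mult_ac)
      then have "\<phi> r powr ((2*m + 1) * m) * r powr m
          = (?w * r powr (1/m + 1)) powr (m - 1) * (?w * r powr (1/m))"
        by (simp only: e)
      also have "\<dots> \<le> D powr (m - 1) * (?w * r powr (1/m))"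
        using m point[OF r] by (intro mult_right_mono powr_mono2) auto
      finally show ?thesis .
    qed
    then show "ennreal (\<phi> r powr ((2*m + 1) * m) * r powr m) * indicator {0<..} r
       \<le> ennreal (D powr (m - 1)) *
      (ennreal (\<phi> r powr (2*m + 1) * r powr (1/m)) * indicator {0<..} r)"
      by (auto simp: indicator_def ennreal_leI simp flip: ennreal_mult')
  qed
  also have "\<dots> = ennreal (D powr (m - 1) * b)"
    using real by (simp add: nn_integral_cmult ennreal_mult')
  also have "\<dots> \<le> ennreal (D powr (m - 1) * D)"
    using bD by (intro ennreal_leI mult_left_mono) auto
  also have "D powr (m - 1) * D = D powr m"
    using bD powr_mult_base[of D "m - 1"] by (simp add: mult.commute)
  finally have "ennpowr ?N (1/m) \<le> ennpowr (ennreal (D powr m)) (1/m)"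
    using m by (intro ennpowr_mono) auto
  also have "\<dots> = ennreal D"
    using bD m by (simp add: ennpowr_ennreal powr_powr)
  finally show ?thesis using real by (simp add: D_def ennreal_mult')
qed

section \<open>The spacetime estimate for a Borel source\<close>

text \<open>The factor \<open>2 powr (2m+1)\<close> occurs once for passing from the mixed norm to a plain spacetime
  integral and once for the choice of the level; \<open>2 m / (m - 1)\<close> is the radial integral of the
  truncated power.\<close>

definition bound_const :: "real \<Rightarrow> real" where
  "bound_const m = 2 powr (2*m + 1) * (2 powr (2*m + 1) * (2 * m / (m - 1)))"

text \<open>The odd source enters only through its absolute value \<open>G\<close> on spacetime, with slice norms \<open>a s\<close> and total
  norm \<open>S\<close>. Slices may be exceptional on a null set of times, so that a Borel representative of a
  Lebesgue measurable source can be used.\<close>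

locale wave_source =
  fixes m :: real and G :: "real \<times> real \<Rightarrow> real" and a :: "real \<Rightarrow> real" and S :: real
  assumes m: "m > 1"
    and G_measurable [measurable]: "G \<in> borel_measurable (borel \<Otimes>\<^sub>M borel)"
    and G_nonneg: "0 \<le> G p"
    and a_measurable [measurable]: "a \<in> borel_measurable borel"
    and a_nonneg: "0 \<le> a s"
    and slice_norm: "AE s in lborel. (\<integral>\<^sup>+\<sigma>. ennreal (G (s, \<sigma>) powr m) \<partial>lborel) = ennreal (a s powr m)"
    and total_norm: "(\<integral>\<^sup>+s. ennreal (a s) \<partial>lborel) = ennreal S" "0 \<le> S"
begin

definition majorant :: "real \<Rightarrow> real \<Rightarrow> ennreal" where
  "majorant = strip_mean (\<lambda>p. ennreal (G p))"

definition trunc_mean :: "real \<Rightarrow> real \<Rightarrow> ennreal" where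
  "trunc_mean t r = strip_mean (\<lambda>p. ennreal (trunc_power m (a (fst p)) r (G p))) t r"

lemma slice_vanishes: "AE s in lborel. a s = 0 \<longrightarrow> (AE \<sigma> in lborel. G (s, \<sigma>) = 0)"
  using slice_norm
proof eventually_elim
  case (elim s)
  show ?case
  proof
    assume "a s = 0"
    with elim have "AE \<sigma> in lborel. ennreal (G (s, \<sigma>) powr m) = 0"
      by (subst nn_integral_0_iff_AE[symmetric]) auto
    then show "AE \<sigma> in lborel. G (s, \<sigma>) = 0"
      by eventually_elim simp
  qed
qed

text \<open>A pointwise bound whose first term depends on time only contributes \<open>c\<close> times the total norm:
  because the level \<open>c a s\<close> is proportional to the slice norm, the sum over slices stays linear. On
  slices of norm zero the level vanishes, but so does the source almost everywhere.\<close>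

lemma majorant_le_of_slices:
  assumes c: "c > 0" and r: "r > 0"
    and [measurable]: "L \<in> borel_measurable (borel \<Otimes>\<^sub>M borel)"
    and le: "\<And>s \<sigma>. a s > 0 \<Longrightarrow> G (s, \<sigma>) \<le> c * a s + L (s, \<sigma>)"
    and L: "\<And>p. 0 \<le> L p"
  shows "majorant t r \<le> ennreal (c * S) + strip_mean (\<lambda>p. ennreal (L p)) t r"
proof -
  have "majorant t r \<le> strip_mean (\<lambda>p. ennreal (c * a (fst p)) + ennreal (L p)) t r"
    unfolding majorant_def
  proof (rule strip_mean_mono_AE)
    show "AE s in lborel. AE \<sigma> in lborel. ennreal (G (s, \<sigma>))
        \<le> ennreal (c * a (fst (s, \<sigma>))) + ennreal (L (s, \<sigma>))"
      using slice_vanishes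
    proof eventually_elim
      case (elim s)
      show ?case
      proof (cases "a s = 0")
        case True
        with elim have "AE \<sigma> in lborel. G (s, \<sigma>) = 0" by simp
        then show ?thesis by eventually_elim simp
      next
        case False
        then have "a s > 0" using a_nonneg[of s] by simp
        then show ?thesis
          using le[of s] c L by (intro AE_I2) (simp add: ennreal_leI flip: ennreal_plus)
      qed
    qed
  qed
  also have "\<dots> = ennreal (c * S) + strip_mean (\<lambda>p. ennreal (L p)) t r"
    using c r strip_mean_of_time_function[of "\<lambda>s. ennreal (c * a s)" r t] total_norm
    by (simp add: strip_mean_add ennreal_mult' nn_integral_cmult)
  finally show ?thesis .
qed

lemma slice_weighted: 
  "(\<integral>\<^sup>+s. \<integral>\<^sup>+\<sigma>. ennreal (a s powr (1 - m) * G (s, \<sigma>) powr m) \<partial>lborel \<partial>lborel) = ennreal S"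
proof -
  have "(\<integral>\<^sup>+s. \<integral>\<^sup>+\<sigma>. ennreal (a s powr (1 - m) * G (s, \<sigma>) powr m) \<partial>lborel \<partial>lborel)
      = (\<integral>\<^sup>+s. ennreal (a s) \<partial>lborel)"
  proof (intro nn_integral_cong_AE)
    show "AE s in lborel. (\<integral>\<^sup>+\<sigma>. ennreal (a s powr (1 - m) * G (s, \<sigma>) powr m) \<partial>lborel) = ennreal (a s)"
      using slice_norm
    proof eventually_elim
      case (elim s)
      have "(\<integral>\<^sup>+\<sigma>. ennreal (a s powr (1 - m) * G (s, \<sigma>) powr m) \<partial>lborel)
         = ennreal (a s powr (1 - m)) * ennreal (a s powr m)"
        by (simp add: ennreal_mult' nn_integral_cmult elim)
      also have "\<dots> = ennreal (a s)"
        using a_nonneg[of s] by (cases "a s = 0") (auto simp flip: ennreal_mult' powr_add)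
      finally show ?case .
    qed
  qed
  then show ?thesis using total_norm by simp
qed

text \<open>This is Hoelder's inequality on an interval of length \<open>2 r\<close>, summed over the slices; the level
  \<open>r powr (-1/m) * a s\<close> balances the two terms of the pointwise bound.\<close>

lemma majorant_decay:
  assumes r: "r > 0"
  shows "majorant t r \<le> ennreal (2 * S * r powr (-1/m))"
proof -
  define c where "c = r powr (-1/m)"
  have c: "c > 0" using r by (simp add: c_def)
  define L where "L p = (c * a (fst p)) powr (1 - m) * G p powr m" for p
  have [measurable]: "L \<in> borel_measurable (borel \<Otimes>\<^sub>M borel)" unfolding L_def by measurable
  have "majorant t r \<le> ennreal (c * S) + strip_mean (\<lambda>p. ennreal (L p)) t r"
    using c r m G_nonneg by (intro majorant_le_of_slices) (auto simp: L_def intro!: le_level_plus_power)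
  also have "strip_mean (\<lambda>p. ennreal (L p)) t r \<le> ennreal (1 / (2 * r)) *
      (\<integral>\<^sup>+s. \<integral>\<^sup>+\<sigma>. ennreal (L (s, \<sigma>)) \<partial>lborel \<partial>lborel)"
    unfolding strip_mean_def
    by (intro mult_left_mono nn_integral_mono) (auto simp: indicator_def)
  also have "(\<integral>\<^sup>+s. \<integral>\<^sup>+\<sigma>. ennreal (L (s, \<sigma>)) \<partial>lborel \<partial>lborel) = ennreal (c powr (1 - m)) * ennreal S"
    unfolding slice_weighted[symmetric]
    by (simp add: L_def powr_mult mult.assoc ennreal_mult' nn_integral_cmult)
  also have "ennreal (1 / (2 * r)) * (ennreal (c powr (1 - m)) * ennreal S) = ennreal (c * S / 2)"
  proof -
    have e: "(-1/m) * (1 - m) = -1/m + 1" using m by (simp add: field_simps)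
    have "c powr (1 - m) = r powr (-1/m + 1)"
      by (simp only: c_def powr_powr e)
    also have "\<dots> = c * r" using r by (simp only: powr_add c_def) simp
    finally have "c powr (1 - m) = c * r" .
    then show ?thesis using r c total_norm by (simp flip: ennreal_mult')
  qed
  also have "ennreal (c * S) + ennreal (c * S / 2) \<le> ennreal (2 * S * c)"
    using c total_norm by (simp flip: ennreal_plus)
  finally show ?thesis by (simp add: c_def add_left_mono)
qed

lemma majorant_level_bound:
  assumes r: "r > 0" and c: "c > 0" "c \<le> r powr (-1/m)"
  shows "majorant t r \<le> ennreal (c * S) + ennreal (c powr (-(2*m))) * trunc_mean t r"
proof -
  have "majorant t r \<le> ennreal (c * S) +
      strip_mean (\<lambda>p. ennreal (c powr (-(2*m)) * trunc_power m (a (fst p)) r (G p))) t r"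
    using c r m G_nonneg
    by (intro majorant_le_of_slices) (auto intro!: le_level_plus_trunc_power trunc_power_nonneg mult_nonneg_nonneg)
  then show ?thesis
    by (simp add: trunc_mean_def ennreal_mult' strip_mean_cmult)
qed

text \<open>Choose the level \<open>c\<close> in the preceding bound so that \<open>c S\<close> is half of the left-hand side and can
  be absorbed; the decay of the majorant guarantees that this \<open>c\<close> is admissible. The result is a
  Jensen inequality in which the power \<open>2m+1\<close> has been replaced by the truncated power.\<close>

lemma majorant_power_le_trunc_mean:
  assumes r: "r > 0"
  shows "ennreal (enn2real (majorant t r) powr (2*m + 1)) \<le> ennreal (2 powr (2*m + 1) * S powr (2*m)) * trunc_mean t r"
proof -
  define v where "v = enn2real (majorant t r)"
  have "majorant t r < top"
    using majorant_decay[OF r, of t] ennreal_less_top by (rule le_less_trans)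
  then have fin: "majorant t r = ennreal v" by (simp add: v_def less_top)
  have v: "v \<ge> 0" "v \<le> 2 * S * r powr (-1/m)"
    using majorant_decay[OF r, of t] total_norm by (auto simp: v_def enn2real_leI)
  show ?thesis
  proof (cases "v = 0")
    case True
    then show ?thesis by (simp flip: v_def)
  next
    case False
    then have vpos: "v > 0" using v by simp
    have S: "S > 0"
      using v vpos total_norm r by (cases "S = 0") auto
    define c where "c = v / (2 * S)"
    have c: "c > 0" "c \<le> r powr (-1/m)" "c * S = v / 2"
      using v vpos S by (auto simp: c_def field_simps)
    have "ennreal (v / 2) + ennreal (v / 2) \<le> ennreal (v / 2) + ennreal (c powr (-(2*m))) * trunc_mean t r"
      using majorant_level_bound[OF r c(1,2), of t] c(3) fin vpos by (simp flip: ennreal_plus)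
    then have "ennreal (v / 2) \<le> ennreal (c powr (-(2*m))) * trunc_mean t r"
      by (simp add: ennreal_add_left_cancel_le)
    then have "ennreal (2 * v powr (2*m) * 2) * ennreal (v / 2)
        \<le> ennreal (2 * v powr (2*m) * 2) * (ennreal (c powr (-(2*m))) * trunc_mean t r)"
      by (intro mult_left_mono) auto
    also have "\<dots> = ennreal (2 * v powr (2*m) * 2 * c powr (-(2*m))) * trunc_mean t r"
      by (simp add: ennreal_mult' mult.assoc)
    also have "2 * v powr (2*m) * 2 * c powr (-(2*m)) = 2 * (2 powr (2*m + 1) * S powr (2*m))"
      using vpos S by (simp add: c_def powr_minus powr_divide powr_mult powr_add)
    finally have "ennreal (2 * v powr (2*m + 1)) \<le> 
        ennreal (2 * (2 powr (2*m + 1) * S powr (2*m))) * trunc_mean t r"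
      using vpos by (simp add: powr_add mult_ac flip: ennreal_mult')
    then have "2 * ennreal (v powr (2*m + 1)) \<le> 2 * (ennreal (2 powr (2*m + 1) * S powr (2*m)) * trunc_mean t r)"
      by (simp add: ennreal_mult' mult.assoc)
    then show ?thesis
      by (simp add: v_def ennreal_mult_le_mult_iff)
  qed
qed

text \<open>After integration in \<open>t\<close> the strips disappear, and the radial integral of the truncated power leaves
  \<open>a powr (1 - m) * G powr m\<close>, whose slices integrate to the slice norms.\<close>

lemma nn_integral_trunc_mean_le:
  "(\<integral>\<^sup>+r\<in>{0<..}. ennreal (r powr (1/m)) * (\<integral>\<^sup>+t. trunc_mean t r \<partial>lborel) \<partial>lborel)
     \<le> ennreal (2 * m / (m - 1) * S)"
proof -
  let ?T = "\<lambda>s \<sigma> r. ennreal (r powr (1/m) * trunc_power m (a s) r (G (s, \<sigma>))) * indicator {0<..} r"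
  have "(\<integral>\<^sup>+r\<in>{0<..}. ennreal (r powr (1/m)) * (\<integral>\<^sup>+t. trunc_mean t r \<partial>lborel) \<partial>lborel)
     = (\<integral>\<^sup>+r. \<integral>\<^sup>+s. \<integral>\<^sup>+\<sigma>. ?T s \<sigma> r \<partial>lborel \<partial>lborel \<partial>lborel)"
  proof (intro nn_integral_cong)
    fix r :: real
    show "ennreal (r powr (1/m)) * (\<integral>\<^sup>+t. trunc_mean t r \<partial>lborel) * indicator {0<..} r =
        (\<integral>\<^sup>+s. \<integral>\<^sup>+\<sigma>. ?T s \<sigma> r \<partial>lborel \<partial>lborel)"
      by (cases "r > 0")
        (simp_all add: trunc_mean_def nn_integral_strip_mean ennreal_mult' nn_integral_cmult)
  qed
  also have "\<dots> = (\<integral>\<^sup>+s. \<integral>\<^sup>+r. \<integral>\<^sup>+\<sigma>. ?T s \<sigma> r \<partial>lborel \<partial>lborel \<partial>lborel)"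
    by (intro lborel_pair.Fubini') measurable
  also have "\<dots> = (\<integral>\<^sup>+s. \<integral>\<^sup>+\<sigma>. \<integral>\<^sup>+r. ?T s \<sigma> r \<partial>lborel \<partial>lborel \<partial>lborel)"
    by (intro nn_integral_cong lborel_pair.Fubini') measurable
  also have "\<dots> \<le> (\<integral>\<^sup>+s. \<integral>\<^sup>+\<sigma>. ennreal (2 * m / (m - 1)) *
      ennreal (a s powr (1 - m) * G (s, \<sigma>) powr m) \<partial>lborel \<partial>lborel)"
    using m nn_integral_trunc_power_le[OF m a_nonneg G_nonneg]
    by (intro nn_integral_mono, subst ennreal_mult'[symmetric]) auto
  also have "\<dots> = ennreal (2 * m / (m - 1) * S)"
    using m by (subst ennreal_mult') (auto simp: nn_integral_cmult slice_weighted)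
  finally show ?thesis .
qed

lemma mixed_norm_majorant_le:
  "(\<integral>\<^sup>+t. ennpowr (\<integral>\<^sup>+r\<in>{0<..}. ennreal (enn2real (majorant t r) powr ((2*m + 1) * m) * r powr m) \<partial>lborel) (1 / m) \<partial>lborel)
     \<le> ennreal (bound_const m * S powr (2*m + 1))"
proof -
  have majorant_meas: "(\<lambda>p. majorant (fst p) (snd p)) \<in> borel_measurable (borel \<Otimes>\<^sub>M borel)"
    unfolding majorant_def by (rule strip_mean_measurable) measurable
  have [measurable]: "(\<lambda>x. majorant (f x) (g x)) \<in> borel_measurable M"
    if [measurable]: "f \<in> borel_measurable M" "g \<in> borel_measurable M" for f g and M :: "'x measure"
    using measurable_compose[OF _ majorant_meas, of "\<lambda>x. (f x, g x)" M] by simp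
  have [measurable]: "(\<lambda>x. trunc_mean (f x) (g x)) \<in> borel_measurable M"
    if [measurable]: "f \<in> borel_measurable M" "g \<in> borel_measurable M" for f g and M :: "'x measure"
    unfolding trunc_mean_def strip_mean_def by measurable
  let ?q = "2*m + 1"
  let ?W = "\<lambda>t r. ennreal (enn2real (majorant t r) powr ?q * r powr (1/m)) * indicator {0<..} r"
  have "(\<integral>\<^sup>+t. ennpowr (\<integral>\<^sup>+r\<in>{0<..}. ennreal (enn2real (majorant t r) powr (?q * m) * r powr m) \<partial>lborel) (1 / m) \<partial>lborel)
     \<le> (\<integral>\<^sup>+t. ennreal (2 powr ?q) * (\<integral>\<^sup>+r. ?W t r \<partial>lborel) \<partial>lborel)"
  proof (intro nn_integral_mono mixed_norm_le_of_doubling m)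
    fix t r \<rho> :: real assume r: "0 < r" "r \<le> \<rho>" "\<rho> \<le> 2 * r"
    have "majorant t \<rho> < top" using majorant_decay[of \<rho> t] r by (simp add: le_less_trans[OF _ ennreal_less_top])
    then have "enn2real (majorant t r) \<le> enn2real (2 * majorant t \<rho>)"
      unfolding majorant_def using r by (intro enn2real_mono strip_mean_overlap) (auto simp: ennreal_mult_less_top)
    then show "enn2real (majorant t r) \<le> 2 * enn2real (majorant t \<rho>)"
      by (simp add: enn2real_mult)
  qed auto
  also have "\<dots> = ennreal (2 powr ?q) * (\<integral>\<^sup>+r. \<integral>\<^sup>+t. ?W t r \<partial>lborel \<partial>lborel)"
    by (subst lborel_pair.Fubini') (auto simp: nn_integral_cmult)
  also have "(\<integral>\<^sup>+r. \<integral>\<^sup>+t. ?W t r \<partial>lborel \<partial>lborel)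
      \<le> (\<integral>\<^sup>+r. ennreal (2 powr ?q * S powr (2*m)) *
           (ennreal (r powr (1/m)) * (\<integral>\<^sup>+t. trunc_mean t r \<partial>lborel) * indicator {0<..} r) \<partial>lborel)"
  proof (intro nn_integral_mono)
    fix r :: real
    let ?k = "ennreal (2 powr ?q * S powr (2*m))"
    show "(\<integral>\<^sup>+t. ?W t r \<partial>lborel) \<le> ?k *
           (ennreal (r powr (1/m)) * (\<integral>\<^sup>+t. trunc_mean t r \<partial>lborel) * indicator {0<..} r)"
    proof (cases "r > 0")
      case True
      have "(\<integral>\<^sup>+t. ?W t r \<partial>lborel) \<le> (\<integral>\<^sup>+t. ennreal (r powr (1/m)) * (?k * trunc_mean t r) \<partial>lborel)"
        using majorant_power_le_trunc_mean[OF True] True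
        by (intro nn_integral_mono) (auto simp: mult.commute[of _ "r powr (1/m)"] ennreal_mult' intro!: mult_left_mono)
      also have "\<dots> = ennreal (r powr (1/m)) * (\<integral>\<^sup>+t. ?k * trunc_mean t r \<partial>lborel)"
        by (rule nn_integral_cmult) measurable
      also have "(\<integral>\<^sup>+t. ?k * trunc_mean t r \<partial>lborel) = ?k * (\<integral>\<^sup>+t. trunc_mean t r \<partial>lborel)"
        by (rule nn_integral_cmult) measurable
      finally show ?thesis using True
        by (simp only: indicator_simps greaterThan_iff mult_1_right mult.left_commute[of ?k])
    qed simp
  qed
  also have "\<dots> \<le> ennreal (2 powr ?q * S powr (2*m)) * ennreal (2 * m / (m - 1) * S)"
    using nn_integral_trunc_mean_le by (subst nn_integral_cmult) (auto intro!: mult_left_mono)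
  also have "ennreal (2 powr ?q) * (ennreal (2 powr ?q * S powr (2*m)) * ennreal (2 * m / (m - 1) * S))
      = ennreal (2 powr ?q * (2 powr ?q * S powr (2*m) * (2 * m / (m - 1) * S)))"
    by (simp only: ennreal_mult' powr_ge_zero mult_nonneg_nonneg)
  also have "2 powr ?q * (2 powr ?q * S powr (2*m) * (2 * m / (m - 1) * S)) = bound_const m * S powr ?q"
    using total_norm powr_mult_base[of S "2*m"] 
    by (simp add: bound_const_def add.commute mult.commute[of S])
  finally show ?thesis
    by (simp add: mult_left_mono)
qed

end

section \<open>Reduction of the wave equation to a Borel source\<close>

text \<open>The exceptional set need not be Borel, so the library rule is applied to a Borel null set
  containing it.\<close>

lemma AE_lborel_affine:
  fixes P :: "real \<Rightarrow> bool"
  assumes "AE x in lborel. P x" "c \<noteq> 0"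
  shows "AE x in lborel. P (b + c * x)"
proof -
  obtain N where N: "N \<in> null_sets lborel" "{x. \<not> P x} \<subseteq> N"
    using assms(1) by (auto simp: eventually_ae_filter)
  have [measurable]: "N \<in> sets borel" using N(1) by auto
  have "AE x in lborel. b + c * x \<notin> N"
    using assms(2) AE_not_in[OF N(1)] by (intro AE_borel_affine) auto
  then show ?thesis
    by eventually_elim (use N(2) in auto)
qed

lemma borel_representative:
  fixes p :: "real \<Rightarrow> real \<Rightarrow> real"
  assumes "(\<lambda>(t, r). p t r) \<in> borel_measurable (lebesgue_on (UNIV \<times> {0<..}))"
  obtains F where "F \<in> borel_measurable (borel \<Otimes>\<^sub>M borel)"
    "AE t in lborel. AE r in lborel. r > 0 \<longrightarrow> p t r = F (t, r)"
proof -
  let ?D = "UNIV \<times> {0<..} :: (real \<times> real) set"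
  have "open ?D" by (intro open_Times) auto
  then have "?D \<in> sets lebesgue" by simp
  then have "(\<lambda>x. if x \<in> ?D then (\<lambda>(t, r). p t r) x else 0) \<in> borel_measurable lebesgue"
    using assms by (subst borel_measurable_if) auto
  then obtain F where F: "F \<in> borel_measurable lborel"
    and eq: "AE x in lborel. (if x \<in> ?D then (\<lambda>(t, r). p t r) x else 0) = F x"
    by (auto dest: completion_ex_borel_measurable_real)
  have "F \<in> borel_measurable (borel \<Otimes>\<^sub>M borel)"
    using F by (simp add: borel_prod)
  moreover have "AE t in lborel. AE r in lborel. r > 0 \<longrightarrow> p t r = F (t, r)"
    using lborel_pair.AE_pair[OF eq[folded lborel_prod]]
    by eventually_elim (auto elim!: eventually_mono)
  ultimately show thesis by (rule that)
qed

text \<open>If the integrand fails to be integrable, the integral is \<open>0\<close> by convention and the bound is trivial.\<close>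

lemma set_integral_abs_le:
  fixes \<phi> :: "'x \<Rightarrow> real"
  shows "ennreal \<bar>LINT x:A|M. \<phi> x\<bar> \<le> (\<integral>\<^sup>+x\<in>A. ennreal \<bar>\<phi> x\<bar> \<partial>M)"
proof (cases "set_integrable M A \<phi>")
  case True
  then have "ennreal \<bar>LINT x:A|M. \<phi> x\<bar> \<le> (\<integral>\<^sup>+x. ennreal \<bar>indicator A x *\<^sub>R \<phi> x\<bar> \<partial>M)"
    using integral_norm_bound_ennreal[of M "\<lambda>x. indicator A x *\<^sub>R \<phi> x"]
    by (simp add: set_lebesgue_integral_def set_integrable_def)
  also have "\<dots> = (\<integral>\<^sup>+x\<in>A. ennreal \<bar>\<phi> x\<bar> \<partial>M)"
    by (intro nn_integral_cong) (auto simp: indicator_def)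
  finally show ?thesis .
next
  case False
  then show ?thesis
    by (simp add: set_lebesgue_integral_def set_integrable_def not_integrable_integral_eq)
qed

lemma interval_integral_abs_le:
  fixes \<phi> :: "real \<Rightarrow> real"
  shows "ennreal \<bar>LINT x=a..b|lebesgue. \<phi> x\<bar> \<le> (\<integral>\<^sup>+x. ennreal \<bar>\<phi> x\<bar> \<partial>lborel)"
proof -
  have "ennreal \<bar>LINT x:A|lebesgue. \<phi> x\<bar> \<le> (\<integral>\<^sup>+x. ennreal \<bar>\<phi> x\<bar> \<partial>lborel)" for A
    by (rule order_trans[OF set_integral_abs_le], subst nn_integral_completion)
      (auto intro!: nn_integral_mono simp: indicator_def)
  then show ?thesis by (simp add: interval_lebesgue_integral_def)
qed

lemma interval_integral_abs_le_of_le: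
  fixes \<phi> :: "real \<Rightarrow> real"
  assumes "a \<le> b"
  shows "ennreal \<bar>LINT x=ereal a..ereal b|lebesgue. \<phi> x\<bar>
    \<le> (\<integral>\<^sup>+x. ennreal \<bar>\<phi> x\<bar> * indicator {a<..<b} x \<partial>lborel)"
  using set_integral_abs_le[of lebesgue "einterval a b" \<phi>] assms
  by (simp add: interval_lebesgue_integral_def nn_integral_completion)

text \<open>Absolute values are taken inside both integrals and the time interval is enlarged to the whole
  line, which treats both signs of \<open>t\<close> at once. The substitution \<open>\<tau> = t - s\<close> then produces a strip
  mean.\<close>

lemma abs_wave_duhamel_le_strip_mean:
  fixes G :: "real \<times> real \<Rightarrow> real"
  assumes [measurable]: "G \<in> borel_measurable (borel \<Otimes>\<^sub>M borel)"
    and source: "AE s in lborel. AE \<sigma> in lborel. \<bar>odd_source f s \<sigma>\<bar> = G (s, \<sigma>)"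
    and x: "norm x = r" "r > 0"
  shows "ennreal \<bar>wave_duhamel f t x\<bar> \<le> strip_mean (\<lambda>p. ennreal (G p)) t r"
proof -
  let ?J = "\<lambda>\<tau>. LINT \<sigma>=ereal (\<tau> - r)..ereal (\<tau> + r)|lebesgue. odd_source f (t - \<tau>) \<sigma>"
  let ?g = "\<lambda>s. \<integral>\<^sup>+\<sigma>. ennreal (G (s, \<sigma>)) * indicator {-r<..<r} (\<sigma> + s - t) \<partial>lborel"
  have "AE \<tau> in lborel. ennreal \<bar>?J \<tau>\<bar> \<le> ?g (t - \<tau>)"
    using AE_lborel_affine[OF source, of "-1" t, simplified]
  proof eventually_elim
    case (elim \<tau>)
    have "ennreal \<bar>?J \<tau>\<bar> \<le> (\<integral>\<^sup>+\<sigma>. ennreal \<bar>odd_source f (t - \<tau>) \<sigma>\<bar> * indicator {\<tau>-r<..<\<tau>+r} \<sigma> \<partial>lborel)"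
      using x by (intro interval_integral_abs_le_of_le) simp
    also have "\<dots> = ?g (t - \<tau>)"
      using elim by (intro nn_integral_cong_AE, eventually_elim) (auto simp: indicator_def)
    finally show ?case .
  qed
  then have "(\<integral>\<^sup>+\<tau>. ennreal \<bar>?J \<tau>\<bar> \<partial>lborel) \<le> (\<integral>\<^sup>+\<tau>. ?g (t - \<tau>) \<partial>lborel)"
    by (rule nn_integral_mono_AE)
  also have "\<dots> = (\<integral>\<^sup>+s. ?g s \<partial>lborel)"
    using nn_integral_real_affine[of ?g "-1" t] by simp
  finally have J: "(\<integral>\<^sup>+\<tau>. ennreal \<bar>?J \<tau>\<bar> \<partial>lborel) \<le> (\<integral>\<^sup>+s. ?g s \<partial>lborel)" .
  have "ennreal \<bar>wave_duhamel f t x\<bar> = ennreal (1 / (2 * r)) * ennreal \<bar>LINT \<tau>=0..ereal t|lebesgue. ?J \<tau>\<bar>"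
    using x by (simp add: wave_duhamel_def abs_mult flip: ennreal_mult')
  also have "\<dots> \<le> strip_mean (\<lambda>p. ennreal (G p)) t r"
    unfolding strip_mean_def
    by (intro mult_left_mono order_trans[OF interval_integral_abs_le J]) simp
  finally show ?thesis .
qed

lemma even_extension_AE:
  assumes "AE r in lborel. r > 0 \<longrightarrow> profile (f s) r = F (s, r)"
  shows "AE \<sigma> in lborel. \<bar>odd_source f s \<sigma>\<bar> = \<bar>\<sigma>\<bar> * \<bar>F (s, \<bar>\<sigma>\<bar>)\<bar>"
  using assms AE_lborel_affine[OF assms, of "-1" 0, simplified]
proof eventually_elim
  case (elim \<sigma>)
  then show ?case
    by (cases "\<sigma> = 0"; cases "\<sigma> > 0") (auto simp: odd_source_def abs_mult)
qed

lemma even_extension_norm_le: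
  fixes h :: "real \<Rightarrow> real"
  assumes m: "m > 0" and [measurable]: "h \<in> borel_measurable borel"
  shows "(\<integral>\<^sup>+\<sigma>. ennreal ((\<bar>\<sigma>\<bar> * \<bar>h \<bar>\<sigma>\<bar>\<bar>) powr m) \<partial>lborel)
    \<le> 2 * (\<integral>\<^sup>+r\<in>{0<..}. ennreal (\<bar>h r\<bar> powr m * r powr m) \<partial>lborel)"
proof -
  let ?E = "\<lambda>r. ennreal (\<bar>h r\<bar> powr m * r powr m) * indicator {0<..} r"
  have "(\<integral>\<^sup>+\<sigma>. ennreal ((\<bar>\<sigma>\<bar> * \<bar>h \<bar>\<sigma>\<bar>\<bar>) powr m) \<partial>lborel) \<le> (\<integral>\<^sup>+\<sigma>. ?E \<sigma> + ?E (-\<sigma>) \<partial>lborel)"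
  proof (intro nn_integral_mono)
    fix \<sigma> :: real
    show "ennreal ((\<bar>\<sigma>\<bar> * \<bar>h \<bar>\<sigma>\<bar>\<bar>) powr m) \<le> ?E \<sigma> + ?E (-\<sigma>)"
      using m by (cases "\<sigma> > 0"; cases "\<sigma> = 0") (auto simp: mult.commute simp flip: powr_mult)
  qed
  also have "\<dots> = (\<integral>\<^sup>+\<sigma>. ?E \<sigma> \<partial>lborel) + (\<integral>\<^sup>+\<sigma>. ?E (-\<sigma>) \<partial>lborel)"
    by (rule nn_integral_add) measurable
  also have "(\<integral>\<^sup>+\<sigma>. ?E (-\<sigma>) \<partial>lborel) = (\<integral>\<^sup>+\<sigma>. ?E \<sigma> \<partial>lborel)"
    using nn_integral_real_affine[of ?E "-1" 0] by simp
  finally show ?thesis by (simp add: mult_2)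
qed

text \<open>Passing to a Borel representative makes all slices measurable at the expense of a null set of
  times; the even extension of \<open>r \<bar>f\<bar>\<close> doubles the \<open>m\<close>-th power of each slice norm. A finite total norm
  forces almost all slice norms to be finite.\<close>

lemma wave_source_of_finite_norm:
  assumes m: "m > 1"
    and meas: "(\<lambda>(t, r). profile (f t) r) \<in> borel_measurable (lebesgue_on (UNIV \<times> {0<..}))"
    and fin: "norm_L1Lm m f < \<infinity>"
  obtains G a S where "wave_source m G a S"
    "AE s in lborel. AE \<sigma> in lborel. \<bar>odd_source f s \<sigma>\<bar> = G (s, \<sigma>)"
    "ennreal S \<le> ennreal (2 powr (1/m)) * norm_L1Lm m f"
proof -
  obtain F where [measurable]: "F \<in> borel_measurable (borel \<Otimes>\<^sub>M borel)"
    and F: "AE t in lborel. AE r in lborel. r > 0 \<longrightarrow> profile (f t) r = F (t, r)"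
    using borel_representative[OF meas] .
  define G where "G = (\<lambda>(s, \<sigma>). \<bar>\<sigma>\<bar> * \<bar>F (s, \<bar>\<sigma>\<bar>)\<bar>)"
  have [measurable]: "G \<in> borel_measurable (borel \<Otimes>\<^sub>M borel)"
    unfolding G_def by measurable
  define H where "H s = (\<integral>\<^sup>+\<sigma>. ennreal (G (s, \<sigma>) powr m) \<partial>lborel)" for s
  have [measurable]: "H \<in> borel_measurable borel"
    unfolding H_def by measurable
  define a where "a s = enn2real (ennpowr (H s) (1/m))" for s
  define k where "k s = (\<integral>\<^sup>+r\<in>{0<..}. ennreal (\<bar>F (s, r)\<bar> powr m * r powr m) \<partial>lborel)" for s
  have [measurable]: "k \<in> borel_measurable borel"
    unfolding k_def by measurable
  have norm_f: "norm_L1Lm m f = (\<integral>\<^sup>+s. ennpowr (k s) (1/m) \<partial>lborel)"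
    unfolding norm_L1Lm_def nn_integral_completion
  proof (intro nn_integral_cong_AE)
    show "AE s in lborel. ennpowr (\<integral>\<^sup>+r\<in>{0<..}. ennreal (\<bar>profile (f s) r\<bar> powr m * r powr m) \<partial>lborel) (1/m)
        = ennpowr (k s) (1/m)"
      using F
    proof eventually_elim
      case (elim s)
      then show ?case unfolding k_def
        by (intro arg_cong2[where f=ennpowr] nn_integral_cong_AE refl, eventually_elim) (auto simp: indicator_def)
    qed
  qed
  have "ennpowr (H s) (1/m) \<le> ennreal (2 powr (1/m)) * ennpowr (k s) (1/m)" for s
  proof -
    have "H s \<le> 2 * k s"
      unfolding H_def k_def G_def prod.case using m by (intro even_extension_norm_le) auto
    then have "ennpowr (H s) (1/m) \<le> ennpowr (ennreal 2 * k s) (1/m)"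
      using m by (intro ennpowr_mono) auto
    then show ?thesis by (simp only: ennpowr_cmult zero_less_numeral)
  qed
  then have "(\<integral>\<^sup>+s. ennpowr (H s) (1/m) \<partial>lborel)
      \<le> (\<integral>\<^sup>+s. ennreal (2 powr (1/m)) * ennpowr (k s) (1/m) \<partial>lborel)"
    by (rule nn_integral_mono)
  also have "\<dots> = ennreal (2 powr (1/m)) * norm_L1Lm m f"
    unfolding norm_f by (rule nn_integral_cmult) measurable
  finally have H_le: "(\<integral>\<^sup>+s. ennpowr (H s) (1/m) \<partial>lborel) \<le> ennreal (2 powr (1/m)) * norm_L1Lm m f" .
  also have "\<dots> < \<infinity>" using fin by (simp add: ennreal_mult_less_top)
  finally have H_fin: "(\<integral>\<^sup>+s. ennpowr (H s) (1/m) \<partial>lborel) < \<infinity>" .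
  have H_AE: "AE s in lborel. ennpowr (H s) (1/m) \<noteq> \<infinity>"
    using H_fin by (intro nn_integral_PInf_AE) auto
  have int_a: "(\<integral>\<^sup>+s. ennreal (a s) \<partial>lborel) = (\<integral>\<^sup>+s. ennpowr (H s) (1/m) \<partial>lborel)"
    using H_AE by (intro nn_integral_cong_AE, eventually_elim) (simp add: a_def less_top[symmetric])
  define S where "S = enn2real (\<integral>\<^sup>+s. ennreal (a s) \<partial>lborel)"
  have S: "ennreal S = (\<integral>\<^sup>+s. ennreal (a s) \<partial>lborel)"
    using H_fin by (simp add: S_def int_a)
  show thesis
  proof (rule that[of G a S])
    show "wave_source m G a S"
    proof
      show "AE s in lborel. (\<integral>\<^sup>+\<sigma>. ennreal (G (s, \<sigma>) powr m) \<partial>lborel) = ennreal (a s powr m)"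
        using H_AE
      proof eventually_elim
        case (elim s)
        then obtain y where y: "H s = ennreal y" "y \<ge> 0" by (cases "H s") (auto simp: ennpowr_def)
        then have "a s powr m = y"
          using m by (simp add: a_def ennpowr_ennreal powr_powr)
        then show ?case using y by (simp add: H_def)
      qed
      show "a \<in> borel_measurable borel" unfolding a_def by measurable
    qed (use m S in \<open>auto simp: G_def a_def S_def\<close>)
    show "AE s in lborel. AE \<sigma> in lborel. \<bar>odd_source f s \<sigma>\<bar> = G (s, \<sigma>)"
      using F unfolding G_def prod.case by eventually_elim (rule even_extension_AE)
    show "ennreal S \<le> ennreal (2 powr (1/m)) * norm_L1Lm m f"
      using H_le by (simp add: S int_a)
  qed
qed

section \<open>The Strichartz-type estimate\<close>

theorem proposition2p7:
  fixes m :: real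
  assumes "m > 1"
  shows "\<exists>C::real. C > 0 \<and>
    (\<forall>(f :: real \<Rightarrow> real^3 \<Rightarrow> real) (u :: real \<Rightarrow> real^3 \<Rightarrow> real).
       (\<forall>t. radial (f t)) \<longrightarrow>
       (\<lambda>(t, r). profile (f t) r) \<in> borel_measurable (lebesgue_on (UNIV \<times> {0<..})) \<longrightarrow>
       norm_L1Lm m f < \<infinity> \<longrightarrow>
       u = wave_duhamel f \<longrightarrow>
       norm_S m u \<le> ennreal C * norm_L1Lm m f)"
proof -
  let ?q = "2*m + 1"
  define C where "C = bound_const m powr (1/?q) * 2 powr (1/m)"
  have bound_pos: "bound_const m > 0" using assms by (simp add: bound_const_def)
  have "norm_S m (wave_duhamel f) \<le> ennreal C * norm_L1Lm m f"
    if meas: "(\<lambda>(t, r). profile (f t) r) \<in> borel_measurable (lebesgue_on (UNIV \<times> {0<..}))"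
      and fin: "norm_L1Lm m f < \<infinity>" for f
  proof -
    obtain G a S where "wave_source m G a S"
      and source: "AE s in lborel. AE \<sigma> in lborel. \<bar>odd_source f s \<sigma>\<bar> = G (s, \<sigma>)"
      and S_le: "ennreal S \<le> ennreal (2 powr (1/m)) * norm_L1Lm m f"
      using wave_source_of_finite_norm[OF assms meas fin] .
    then interpret wave_source m G a S by simp
    have pointwise: "\<bar>profile (wave_duhamel f t) r\<bar> \<le> enn2real (majorant t r)" if r: "r > 0" for t r
    proof -
      have "ennreal \<bar>profile (wave_duhamel f t) r\<bar> \<le> majorant t r"
        unfolding profile_def majorant_def using r
        by (intro abs_wave_duhamel_le_strip_mean source) (auto simp: norm_axis_1)
      moreover have "majorant t r < top"
        using majorant_decay[OF r] ennreal_less_top by (rule le_less_trans)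
      ultimately show ?thesis
        using enn2real_mono[of "ennreal \<bar>profile (wave_duhamel f t) r\<bar>" "majorant t r"] by simp
    qed
    have "norm_S m (wave_duhamel f) \<le> ennpowr
       (\<integral>\<^sup>+t. ennpowr (\<integral>\<^sup>+r\<in>{0<..}. ennreal (enn2real (majorant t r) powr (?q * m) * r powr m) \<partial>lborel) (1 / m) \<partial>lborel)
       (1 / ?q)"
      unfolding norm_S_def nn_integral_completion
      using assms pointwise
      by (intro ennpowr_mono nn_integral_mono)
        (auto simp: indicator_def intro!: ennreal_leI mult_right_mono powr_mono2)
    also have "\<dots> \<le> ennpowr (ennreal (bound_const m * S powr ?q)) (1 / ?q)"
      using assms by (intro ennpowr_mono mixed_norm_majorant_le) auto
    also have "\<dots> = ennreal (bound_const m powr (1/?q)) * ennreal S"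
      using bound_pos total_norm assms
      by (simp add: ennpowr_ennreal powr_mult powr_powr flip: ennreal_mult')
    also have "\<dots> \<le> ennreal (bound_const m powr (1/?q)) * (ennreal (2 powr (1/m)) * norm_L1Lm m f)"
      by (intro mult_left_mono S_le) simp
    also have "\<dots> = ennreal C * norm_L1Lm m f"
      by (simp add: C_def ennreal_mult' mult.assoc)
    finally show ?thesis .
  qed
  moreover have "C > 0" using bound_pos by (simp add: C_def)
  ultimately show ?thesis by blast
qed

end
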